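(* Let $\{X_k(p,q,r)\}$ be the third-order linear recurrence sequence defined by $X_{k+3}=pX_{k+2}+qX_{k+1}+rX_k$ with the initial values $X_0=0$, $X_1=0$, $X_2=1$. The following algorithm takes as input $p,q,r$ and $N=\sum_{i=0}^{m-1}b_i2^i$ (binary expansion, with $b_{m-1}=1$) and outputs $X_N$, $X_{N+1}$, $X_{N+2}$. It uses six temporary memories, $x_1,x_2,x_3$ (lower case) and $T_1,T_2,T_3$. Start with $(T_1,T_2,T_3)\leftarrow(0,1,p)$. For $j$ from $m-2$ down to $0$ by steps of $-1$, first put $(x_1,x_2,x_3)\leftarrow(T_1,T_2,T_3)$, and then: if $b_j=1$, put $$T_1\leftarrow r x_1^2+x_2(2x_3-px_2),\quad T_2\leftarrow x_3^2+x_2(qx_2+2rx_1),\quad T_3\leftarrow r x_2^2+x_3(px_3+2qx_2+2rx_1);$$ otherwise, put $$T_1\leftarrow x_2^2+x_1(2x_3-2px_2-qx_1),\quad T_2\leftarrow r x_1^2+x_2(2x_3-px_2),\quad T_3\leftarrow x_3^2+x_2(qx_2+2rx_1).$$ Finally return $T_1,T_2,T_3$, which are $X_N,X_{N+1},X_{N+2}$. With multiplications by $p,q,r$ regarded as simulated by additions, the algorithm needs $3m$ multiplications and $3m$ squarings.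
   Context: Here $m$ is the number of binary digits of $N$. Multiplications by $p,q,r$ are treated as additions and are not counted. Each product of the form $x_i(\cdots)$ in the displayed formulas is a multiplication and each $x_i^2$ is a squaring.
   Formalization: With m the number of binary digits the loop runs m-1 times, so the exact count is 3(m-1) multiplications and 3(m-1) squarings (none for N = 1); the formal theorem proves this exact count and reads "needs 3m" as the upper bound 3m. *)

theory Defs
  imports Main
begin

fun X :: "'a::comm_ring_1 \<Rightarrow> 'a \<Rightarrow> 'a \<Rightarrow> nat \<Rightarrow> 'a" where
  "X p q r 0 = 0"
| "X p q r (Suc 0) = 0"
| "X p q r (Suc (Suc 0)) = 1"
| "X p q r (Suc (Suc (Suc k))) =
     p * X p q r (Suc (Suc k)) + q * X p q r (Suc k) + r * X p q r k"

text \<open>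
  The algorithm is represented by its syntax, so that its arithmetic operations can be counted
  on the formulas as they are displayed. The six memories and the three parameters are:
\<close>

datatype mem = x\<^sub>1 | x\<^sub>2 | x\<^sub>3 | T\<^sub>1 | T\<^sub>2 | T\<^sub>3

datatype param = par_p | par_q | par_r

text \<open>
  \<open>Prod x e\<close> is a product \<open>x_i (\<dots>)\<close> and \<open>Sq x\<close> a square \<open>x_i^2\<close>; these are the only operations
  that are counted. \<open>Scale c e\<close> is a multiplication by one of the parameters and \<open>Dbl e\<close> is
  the sum \<open>e + e\<close>, written as a coefficient 2 in the formulas; both are free, like additions.
\<close>

datatype expr =
    Lit nat
  | Par param
  | Mem mem
  | Plus expr expr (infixl "\<oplus>" 65)
  | Minus expr expr (infixl "\<ominus>" 65)
  | Dbl expr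
  | Scale param expr (infixr "\<bullet>" 75)
  | Prod mem expr (infixr "\<odot>" 70)
  | Sq mem

fun par :: "'a \<Rightarrow> 'a \<Rightarrow> 'a \<Rightarrow> param \<Rightarrow> 'a" where
  "par p q r par_p = p"
| "par p q r par_q = q"
| "par p q r par_r = r"

fun val :: "(param \<Rightarrow> 'a::comm_ring_1) \<Rightarrow> (mem \<Rightarrow> 'a) \<Rightarrow> expr \<Rightarrow> 'a" where
  "val \<pi> s (Lit n) = of_nat n"
| "val \<pi> s (Par c) = \<pi> c"
| "val \<pi> s (Mem x) = s x"
| "val \<pi> s (e \<oplus> f) = val \<pi> s e + val \<pi> s f"
| "val \<pi> s (e \<ominus> f) = val \<pi> s e - val \<pi> s f"
| "val \<pi> s (Dbl e) = val \<pi> s e + val \<pi> s e"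
| "val \<pi> s (c \<bullet> e) = \<pi> c * val \<pi> s e"
| "val \<pi> s (x \<odot> e) = s x * val \<pi> s e"
| "val \<pi> s (Sq x) = (s x)\<^sup>2"

fun muls :: "expr \<Rightarrow> nat" where
  "muls (Lit n) = 0"
| "muls (Par c) = 0"
| "muls (Mem x) = 0"
| "muls (e \<oplus> f) = muls e + muls f"
| "muls (e \<ominus> f) = muls e + muls f"
| "muls (Dbl e) = muls e"
| "muls (c \<bullet> e) = muls e"
| "muls (x \<odot> e) = Suc (muls e)"
| "muls (Sq x) = 0"

fun sqs :: "expr \<Rightarrow> nat" where
  "sqs (Lit n) = 0"
| "sqs (Par c) = 0"
| "sqs (Mem x) = 0"
| "sqs (e \<oplus> f) = sqs e + sqs f"
| "sqs (e \<ominus> f) = sqs e + sqs f"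
| "sqs (Dbl e) = sqs e"
| "sqs (c \<bullet> e) = sqs e"
| "sqs (x \<odot> e) = sqs e"
| "sqs (Sq x) = 1"

record 'a state =
  store :: "mem \<Rightarrow> 'a"
  mul_count :: nat
  sq_count :: nat

text \<open>Assignments are executed one after the other, each on the store left by the previous one.\<close>

datatype assignment = Assign mem expr (infix "\<leftarrow>" 60)

fun step :: "(param \<Rightarrow> 'a::comm_ring_1) \<Rightarrow> assignment \<Rightarrow> 'a state \<Rightarrow> 'a state" where
  "step \<pi> (x \<leftarrow> e) S =
     \<lparr> store = (store S)(x := val \<pi> (store S) e),
       mul_count = mul_count S + muls e,
       sq_count = sq_count S + sqs e \<rparr>"

definition exec :: "(param \<Rightarrow> 'a::comm_ring_1) \<Rightarrow> assignment list \<Rightarrow> 'a state \<Rightarrow> 'a state" where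
  "exec \<pi> cs S = fold (step \<pi>) cs S"

definition start :: "assignment list" where
  "start = [T\<^sub>1 \<leftarrow> Lit 0, T\<^sub>2 \<leftarrow> Lit 1, T\<^sub>3 \<leftarrow> Par par_p]"

definition copy :: "assignment list" where
  "copy = [x\<^sub>1 \<leftarrow> Mem T\<^sub>1, x\<^sub>2 \<leftarrow> Mem T\<^sub>2, x\<^sub>3 \<leftarrow> Mem T\<^sub>3]"

definition branch_one :: "assignment list" where
  "branch_one =
    [T\<^sub>1 \<leftarrow> par_r \<bullet> Sq x\<^sub>1 \<oplus> x\<^sub>2 \<odot> (Dbl (Mem x\<^sub>3) \<ominus> par_p \<bullet> Mem x\<^sub>2),
     T\<^sub>2 \<leftarrow> Sq x\<^sub>3 \<oplus> x\<^sub>2 \<odot> (par_q \<bullet> Mem x\<^sub>2 \<oplus> Dbl (par_r \<bullet> Mem x\<^sub>1)),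
     T\<^sub>3 \<leftarrow> par_r \<bullet> Sq x\<^sub>2 \<oplus>
        x\<^sub>3 \<odot> (par_p \<bullet> Mem x\<^sub>3 \<oplus> Dbl (par_q \<bullet> Mem x\<^sub>2) \<oplus> Dbl (par_r \<bullet> Mem x\<^sub>1))]"

definition branch_zero :: "assignment list" where
  "branch_zero =
    [T\<^sub>1 \<leftarrow> Sq x\<^sub>2 \<oplus>
        x\<^sub>1 \<odot> (Dbl (Mem x\<^sub>3) \<ominus> Dbl (par_p \<bullet> Mem x\<^sub>2) \<ominus> par_q \<bullet> Mem x\<^sub>1),
     T\<^sub>2 \<leftarrow> par_r \<bullet> Sq x\<^sub>1 \<oplus> x\<^sub>2 \<odot> (Dbl (Mem x\<^sub>3) \<ominus> par_p \<bullet> Mem x\<^sub>2),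
     T\<^sub>3 \<leftarrow> Sq x\<^sub>3 \<oplus> x\<^sub>2 \<odot> (par_q \<bullet> Mem x\<^sub>2 \<oplus> Dbl (par_r \<bullet> Mem x\<^sub>1))]"

definition body :: "nat \<Rightarrow> assignment list" where
  "body d = copy @ (if d = 1 then branch_one else branch_zero)"

text \<open>
  The list \<open>rev [0..<m - 1]\<close> is \<open>m - 2, \<dots>, 0\<close>, and is empty for \<open>m = 1\<close>. The argument \<open>s\<close> is the
  content of the memories before the algorithm starts.
\<close>

definition algorithm ::
  "'a::comm_ring_1 \<Rightarrow> 'a \<Rightarrow> 'a \<Rightarrow> nat \<Rightarrow> (nat \<Rightarrow> nat) \<Rightarrow> (mem \<Rightarrow> 'a) \<Rightarrow> 'a state" where
  "algorithm p q r m b s =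
     fold (\<lambda>j. exec (par p q r) (body (b j))) (rev [0..<m - 1])
       (exec (par p q r) start \<lparr> store = s, mul_count = 0, sq_count = 0 \<rparr>)"

end

theory Submission
  imports Defs
begin

text \<open>
  Every shift of the sequence satisfies the same recurrence, hence is determined linearly by its
  first three terms; this gives an addition formula for \<open>X\<^bsub>n+k\<^esub>\<close>. Specialised to \<open>k = n\<close>,
  to \<open>k = n + 1\<close> and to both indices raised, it yields the displayed assignments, which thus
  turn the triple at \<open>n\<close> into the triple at \<open>2 n + b\<^sub>j\<close>, as in Horner's rule for the binary
  expansion of \<open>N\<close>.
\<close>

text \<open>In \<open>k\<close>, the coefficients of \<open>X p q r (n + 2)\<close>,
  \<open>X p q r (n + 1)\<close> and \<open>X p q r n\<close> solve the recurrence with initial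
  values (0,0,1), (0,1,0) and (1,0,0).\<close>

lemma X_add:
  fixes p q r :: "'a::comm_ring_1"
  shows "X p q r (n + k) = X p q r k * X p q r (n + 2)
     + (X p q r (k + 1) - p * X p q r k) * X p q r (n + 1)
     + (X p q r (k + 2) - p * X p q r (k + 1) - q * X p q r k) * X p q r n"
proof (induction p q r k rule: X.induct)
  case (4 p q r k)
  have "X p q r (n + Suc (Suc (Suc k))) =
      p * X p q r (n + Suc (Suc k)) + q * X p q r (n + Suc k) + r * X p q r (n + k)"
    by simp
  then show ?case
    unfolding 4 by (simp add: algebra_simps)
qed (simp_all add: algebra_simps)

text \<open>Doubled terms are spelled as sums because \<open>val\<close> evaluates
  \<open>Dbl\<close> that way.\<close>

lemma X_double:
  fixes p q r :: "'a::comm_ring_1"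
  defines "x \<equiv> X p q r"
  shows "x (2 * n) = (x (n + 1))\<^sup>2
     + x n * (x (n + 2) + x (n + 2) - (p * x (n + 1) + p * x (n + 1)) - q * x n)"
  using X_add[of p q r n n]
  by (simp add: x_def mult_2_right[of n] power2_eq_square algebra_simps)

text \<open>With \<open>k = n + 1\<close> the last coefficient in \<open>X_add\<close> collapses to
  \<open>r * x n\<close> by the recurrence.\<close>

lemma X_double_Suc:
  fixes p q r :: "'a::comm_ring_1"
  defines "x \<equiv> X p q r"
  shows "x (2 * n + 1) = r * (x n)\<^sup>2 + x (n + 1) * (x (n + 2) + x (n + 2) - p * x (n + 1))"
  using X_add[of p q r n "n + 1"]
  by (simp add: x_def mult_2_right[of n] power2_eq_square algebra_simps)

lemma X_double_Suc2:
  fixes p q r :: "'a::comm_ring_1"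
  defines "x \<equiv> X p q r"
  shows "x (2 * n + 2) = (x (n + 2))\<^sup>2 + x (n + 1) * (q * x (n + 1) + (r * x n + r * x n))"
  using X_add[of p q r "n + 1" "n + 1"]
  by (simp add: x_def mult_2_right[of n] power2_eq_square algebra_simps)

lemma X_double_Suc3:
  fixes p q r :: "'a::comm_ring_1"
  defines "x \<equiv> X p q r"
  shows "x (2 * n + 3) = r * (x (n + 1))\<^sup>2 + x (n + 2) *
     (p * x (n + 2) + (q * x (n + 1) + q * x (n + 1)) + (r * x n + r * x n))"
  using X_add[of p q r "n + 1" "n + 2"]
  by (simp add: x_def mult_2_right[of n] power2_eq_square algebra_simps numeral_3_eq_3)

definition holds_at :: "'a::comm_ring_1 \<Rightarrow> 'a \<Rightarrow> 'a \<Rightarrow> 'a state \<Rightarrow> nat \<Rightarrow> bool" where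
  "holds_at p q r S n \<longleftrightarrow>
     store S T\<^sub>1 = X p q r n \<and> store S T\<^sub>2 = X p q r (n + 1) \<and> store S T\<^sub>3 = X p q r (n + 2)"

text \<open>The branches read only the copies in \<open>x\<^sub>1\<close>, \<open>x\<^sub>2\<close>,
  \<open>x\<^sub>3\<close>, so their sequential assignments act simultaneously.\<close>

lemma holds_at_exec_body:
  assumes "holds_at p q r S n" "d \<in> {0, 1}"
  shows "holds_at p q r (exec (par p q r) (body d) S) (2 * n + d)"
proof (cases "d = 1")
  case True
  \<comment> \<open>These bring the indices into the literal form that the doubling lemmas
    rewrite.\<close>
  have "2 * n + 1 + 1 = 2 * n + 2" "2 * n + 1 + 2 = 2 * n + 3" by simp_all
  with True assms(1) show ?thesis
    unfolding holds_at_def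
    by (simp only: X_double_Suc X_double_Suc2 X_double_Suc3)
      (simp add: exec_def body_def copy_def branch_one_def)
next
  case False
  with assms(2) have "d = 0" by simp
  with assms(1) show ?thesis
    unfolding holds_at_def
    by (simp only: add_0_right X_double X_double_Suc X_double_Suc2)
      (simp add: exec_def body_def copy_def branch_zero_def)
qed

text \<open>In both branches each of the three assignments has one \<open>Prod\<close> and one
  \<open>Sq\<close>; copying is free.\<close>

lemma count_exec_body:
  "mul_count (exec \<pi> (body d) S) = mul_count S + 3"
  "sq_count (exec \<pi> (body d) S) = sq_count S + 3"
  by (simp_all add: exec_def body_def copy_def branch_one_def branch_zero_def)

text \<open>The list for \<open>Suc k\<close> begins with \<open>k\<close>, so the induction peels
  off the highest bit and resumes from \<open>2 * n + b k\<close>; hence \<open>n\<close> and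
  \<open>S\<close> are arbitrary.\<close>

lemma holds_at_fold_body:
  assumes "holds_at p q r S n" "\<forall>i<k. b i \<in> {0, 1}"
  shows "holds_at p q r (fold (\<lambda>j. exec (par p q r) (body (b j))) (rev [0..<k]) S)
    (n * 2 ^ k + (\<Sum>i<k. b i * 2 ^ i))"
  using assms
proof (induction k arbitrary: n S)
  case (Suc k)
  have "holds_at p q r (exec (par p q r) (body (b k)) S) (2 * n + b k)"
    using Suc.prems by (intro holds_at_exec_body) auto
  from Suc.IH[OF this] Suc.prems(2) show ?case
    by (simp add: algebra_simps)
qed simp

lemma count_fold_body:
  "mul_count (fold (\<lambda>j. exec \<pi> (body (b j))) js S) = mul_count S + 3 * length js"
  "sq_count (fold (\<lambda>j. exec \<pi> (body (b j))) js S) = sq_count S + 3 * length js"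
  by (induction js arbitrary: S) (simp_all add: count_exec_body)

theorem mainTheorem1:
  fixes p q r :: "'a::comm_ring_1"
    and N m :: nat
    and b :: "nat \<Rightarrow> nat"
    and s :: "mem \<Rightarrow> 'a"
  assumes "m \<ge> 1"
    and "\<forall>i<m. b i \<in> {0, 1}"
    and "b (m - 1) = 1"
    and "N = (\<Sum>i<m. b i * 2 ^ i)"
  shows "let S = algorithm p q r m b s in
       store S T\<^sub>1 = X p q r N
       \<and> store S T\<^sub>2 = X p q r (N + 1)
       \<and> store S T\<^sub>3 = X p q r (N + 2)
       \<and> mul_count S = 3 * (m - 1) \<and> mul_count S \<le> 3 * m
       \<and> sq_count S = 3 * (m - 1) \<and> sq_count S \<le> 3 * m"
proof -
  define S where "S = exec (par p q r) start \<lparr> store = s, mul_count = 0, sq_count = 0 \<rparr>"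
  \<comment> \<open>The initial triple (0,1,p) sits at index 1: the leading bit is already consumed,
    which leaves \<open>m - 1\<close> rounds.\<close>
  have S: "holds_at p q r S 1" "mul_count S = 0" "sq_count S = 0"
    by (simp_all add: S_def holds_at_def exec_def start_def numeral_3_eq_3 numeral_2_eq_2)
  obtain k where m: "m = Suc k"
    using assms(1) by (cases m) auto
  \<comment> \<open>The leading bit supplies the start index 1 in
    \<open>holds_at_fold_body\<close>.\<close>
  have "N = 1 * 2 ^ k + (\<Sum>i<k. b i * 2 ^ i)"
    using assms(3,4) m by simp
  then have "holds_at p q r (algorithm p q r m b s) N"
    using holds_at_fold_body[OF S(1), of k b] assms(2) m
    by (simp add: algorithm_def S_def)
  moreover have "mul_count (algorithm p q r m b s) = 3 * (m - 1)"
    "sq_count (algorithm p q r m b s) = 3 * (m - 1)"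
    using S(2,3) by (simp_all add: algorithm_def count_fold_body flip: S_def)
  ultimately show ?thesis
    by (simp add: Let_def holds_at_def)
qed

end
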